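(* Let $U$ be a complete length $\mathrm{CAT}(1)$ space. Assume there is a point $p\in U$ such that $|p-x|\le\tfrac\pi2$ for every $x\in U$. Then $U$ is $1$-complemented; that is, for some non-principal ultrafilter $\omega$ on $\mathbb{N}$ there exists a short retraction of the ultracompletion $U^\omega$ onto $U$.
   Context: For a non-principal ultrafilter $\omega$ on $\mathbb{N}$ and a bounded metric space $U$ (the space here has diameter at most $\pi$), the ultracompletion $U^\omega$ is the set of all sequences $(x_n)$ in $U$ modulo the relation $(x_n)\sim(y_n)$ iff $\lim_\omega |x_n-y_n|=0$, with metric $|(x_n)-(y_n)|=\lim_\omega|x_n-y_n|$; $U$ is regarded as a subset of $U^\omega$ via constant sequences. A short retraction of $U^\omega$ onto $U$ is a 1-Lipschitz map $U^\omega\to U$ that restricts to the identity on $U$. A metric space is $1$-complemented if for some non-principal ultrafilter $\omega$ there is a short retraction $U^\omega\to U$. *)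

theory Defs
  imports "HOL-Analysis.Analysis"
begin

text \<open>A subset U of a metric space (with the induced metric) is a length space if any two
points x, y can be joined by a path in U of length at most |x-y| + e, for every e > 0.
The length of a path is the supremum of inscribed polygonal sums; "length at most L" is
written out as: every inscribed polygonal sum is at most L.\<close>

definition length_space :: "'a::metric_space set \<Rightarrow> bool" where
  "length_space U \<longleftrightarrow>
     (\<forall>x\<in>U. \<forall>y\<in>U. \<forall>e>0. \<exists>(\<gamma>::real \<Rightarrow> 'a) a b.
        a \<le> b \<and> continuous_on {a..b} \<gamma> \<and> \<gamma> ` {a..b} \<subseteq> U \<and> \<gamma> a = x \<and> \<gamma> b = y \<and>
        (\<forall>(n::nat) (t::nat \<Rightarrow> real). t 0 = a \<and> t n = b \<and> (\<forall>i<n. t i \<le> t (Suc i)) \<longrightarrow>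
            (\<Sum>i<n. dist (\<gamma> (t i)) (\<gamma> (t (Suc i)))) \<le> dist x y + e))"

definition geodesic_in :: "'a::metric_space set \<Rightarrow> (real \<Rightarrow> 'a) \<Rightarrow> 'a \<Rightarrow> 'a \<Rightarrow> bool" where
  "geodesic_in U \<gamma> x y \<longleftrightarrow> \<gamma> 0 = x \<and> \<gamma> (dist x y) = y \<and>
     (\<forall>s\<in>{0..dist x y}. \<gamma> s \<in> U) \<and>
     (\<forall>s\<in>{0..dist x y}. \<forall>t\<in>{0..dist x y}. dist (\<gamma> s) (\<gamma> t) = \<bar>s - t\<bar>)"

definition S2 :: "(real^3) set" where "S2 = sphere 0 1"

definition sdist :: "real^3 \<Rightarrow> real^3 \<Rightarrow> real" where
  "sdist u v = arccos (u \<bullet> v)"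

definition CAT1 :: "'a::metric_space set \<Rightarrow> bool" where
  "CAT1 U \<longleftrightarrow>
     (\<forall>x\<in>U. \<forall>y\<in>U. dist x y < pi \<longrightarrow> (\<exists>\<gamma>. geodesic_in U \<gamma> x y)) \<and>
     (\<forall>x\<in>U. \<forall>y\<in>U. \<forall>z\<in>U. \<forall>\<gamma> t x' y' z' p'.
        geodesic_in U \<gamma> x y \<and> dist x y + dist y z + dist z x < 2 * pi \<and>
        0 \<le> t \<and> t \<le> dist x y \<and>
        x' \<in> S2 \<and> y' \<in> S2 \<and> z' \<in> S2 \<and> p' \<in> S2 \<and>
        sdist x' y' = dist x y \<and> sdist y' z' = dist y z \<and> sdist z' x' = dist z x \<and>
        sdist x' p' = t \<and> sdist p' y' = dist x y - t
        \<longrightarrow> dist z (\<gamma> t) \<le> sdist z' p')"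

definition ultrafilter :: "'i filter \<Rightarrow> bool" where
  "ultrafilter F \<longleftrightarrow> F \<noteq> bot \<and> (\<forall>P. eventually P F \<or> eventually (\<lambda>n. \<not> P n) F)"

definition nonprincipal_ultrafilter :: "nat filter \<Rightarrow> bool" where
  "nonprincipal_ultrafilter \<omega> \<longleftrightarrow> ultrafilter \<omega> \<and> (\<forall>n. \<omega> \<noteq> principal {n})"

definition ultra_dist :: "nat filter \<Rightarrow> (nat \<Rightarrow> 'a::metric_space) \<Rightarrow> (nat \<Rightarrow> 'a) \<Rightarrow> real" where
  "ultra_dist \<omega> x y = Lim \<omega> (\<lambda>n. dist (x n) (y n))"

text \<open>A short retraction U^\<omega> \<rightarrow> U, represented as a map on the sequences in U
(maps on the quotient U^\<omega> correspond exactly to such maps that are 1-Lipschitz for the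
pseudometric ultra_dist, since 1-Lipschitz maps are constant on equivalence classes).
U is embedded in U^\<omega> via constant sequences.\<close>
definition short_retraction :: "nat filter \<Rightarrow> 'a::metric_space set \<Rightarrow> ((nat \<Rightarrow> 'a) \<Rightarrow> 'a) \<Rightarrow> bool" where
  "short_retraction \<omega> U R \<longleftrightarrow>
     (\<forall>x. (\<forall>n. x n \<in> U) \<longrightarrow> R x \<in> U) \<and>
     (\<forall>x y. (\<forall>n. x n \<in> U) \<and> (\<forall>n. y n \<in> U) \<longrightarrow> dist (R x) (R y) \<le> ultra_dist \<omega> x y) \<and>
     (\<forall>u\<in>U. R (\<lambda>n. u) = u)"

definition one_complemented :: "'a::metric_space set \<Rightarrow> bool" where
  "one_complemented U \<longleftrightarrow> (\<exists>\<omega>. nonprincipal_ultrafilter \<omega> \<and> (\<exists>R. short_retraction \<omega> U R))"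

end

theory Submission
  imports Defs
begin

text \<open>
  Write \<open>\<langle>u,v\<rangle>\<close> for \<open>cos |u-v|\<close>, extended to sequences by ultralimits. For a point \<open>x\<close> of the
  ultracompletion let \<open>c\<close> be the largest number with \<open>\<langle>x,u\<rangle> + c\<langle>p,u\<rangle> \<le> 1\<close> for all \<open>u \<in> U\<close>. Functions
  of the form \<open>\<langle>x,\<cdot>\<rangle> + c\<langle>p,\<cdot>\<rangle>\<close> are concave when extended homogeneously to the Euclidean cone over
  \<open>U\<close>, so by completeness the value \<open>1\<close> is attained at a point \<open>a \<in> U\<close>, which is the image of \<open>x\<close>;
  equivalently, \<open>a\<close> minimizes Kendall's function \<open>(1 - \<langle>x,u\<rangle>) / \<langle>p,u\<rangle>\<close>. The first-order condition at
  \<open>a\<close> reads \<open>\<langle>x,u\<rangle> + c\<langle>p,u\<rangle> \<le> \<langle>a,u\<rangle>\<close> for all \<open>u \<in> U\<close>. If \<open>y\<close> is mapped to \<open>b\<close>, these conditions and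
  the CAT(0) quadrilateral inequality for the cone points \<open>x/\<langle>p,a\<rangle>\<close>, \<open>a/\<langle>p,a\<rangle>\<close>, \<open>b/\<langle>p,b\<rangle>\<close>, \<open>y/\<langle>p,b\<rangle>\<close>
  give \<open>\<langle>x,y\<rangle> \<le> \<langle>a,b\<rangle>\<close>.
\<close>

section \<open>Spherical trigonometry and planar cone inequalities\<close>

text \<open>Take \<open>x\<close> as the first basis vector and \<open>y\<close> in the plane of the
  first two. The prescribed products then force the second coordinate \<open>w\<close> of
  \<open>z\<close>. The triangle inequalities and the perimeter bound give
  \<open>\<bar>w\<bar> \<le> sin r\<close>, which leaves room for the third coordinate.\<close>

lemma comparison_triangle_exists:
  fixes l r s :: real
  assumes l: "0 < l" "l < pi" and r: "0 \<le> r" "r \<le> pi" and s: "0 \<le> s" "s \<le> pi"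
    and tri: "l \<le> r + s" "r \<le> l + s" "s \<le> l + r" and per: "l + r + s < 2 * pi"
  obtains x y z where "x \<in> S2" "y \<in> S2" "z \<in> S2"
    "x \<bullet> y = cos l" "x \<bullet> z = cos r" "y \<bullet> z = cos s"
proof -
  define w where "w = (cos s - cos r * cos l) / sin l"
  have sl: "sin l > 0" using l by (simp add: sin_gt_zero)
  have sr: "sin r \<ge> 0" using r by (simp add: sin_ge_zero)
  have up: "cos s \<le> cos (r - l)"
  proof (cases "r \<ge> l")
    case True
    then show ?thesis using cos_monotone_0_pi_le[of "r - l" s] tri s by simp
  next
    case False
    then have "cos s \<le> cos (l - r)" using cos_monotone_0_pi_le[of "l - r" s] tri s by simp
    also have "cos (l - r) = cos (r - l)" by (metis cos_minus minus_diff_eq)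
    finally show ?thesis .
  qed
  have lo: "cos (r + l) \<le> cos s"
  proof (cases "r + l \<le> pi")
    case True
    then show ?thesis using cos_monotone_0_pi_le[of s "r + l"] tri s by simp
  next
    case False
    then have "cos (2 * pi - (r + l)) \<le> cos s"
      using cos_monotone_0_pi_le[of s "2 * pi - (r + l)"] per s by simp
    then show ?thesis by (simp add: cos_diff)
  qed
  have "\<bar>cos s - cos r * cos l\<bar> \<le> sin r * sin l"
    using up lo by (simp add: cos_add cos_diff)
  then have "\<bar>w\<bar> \<le> sin r" using sl by (simp add: w_def field_simps)
  then have "w\<^sup>2 \<le> (sin r)\<^sup>2" using sr by (metis abs_le_square_iff abs_of_nonneg)
  then have nn: "0 \<le> 1 - (cos r)\<^sup>2 - w\<^sup>2" using sin_cos_squared_add[of r] by linarith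
  define x :: "real^3" where "x = vector [1, 0, 0]"
  define y :: "real^3" where "y = vector [cos l, sin l, 0]"
  define z :: "real^3" where "z = vector [cos r, w, sqrt (1 - (cos r)\<^sup>2 - w\<^sup>2)]"
  have ip: "a \<bullet> b = a $ 1 * b $ 1 + a $ 2 * b $ 2 + a $ 3 * b $ 3" for a b :: "real^3"
    by (simp add: inner_vec_def sum_3)
  have S: "a \<in> S2 \<longleftrightarrow> a \<bullet> a = 1" for a :: "real^3"
    by (simp add: S2_def norm_eq_1)
  show ?thesis
  proof
    show "x \<in> S2" by (simp add: S ip x_def)
    show "y \<in> S2" using sin_cos_squared_add2[of l] by (simp add: S ip y_def power2_eq_square)
    show "z \<in> S2" using nn by (simp add: S ip z_def power2_eq_square)
    show "x \<bullet> y = cos l" "x \<bullet> z = cos r" by (simp_all add: ip x_def y_def z_def)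
    show "y \<bullet> z = cos s" using sl by (simp add: ip y_def z_def w_def)
  qed
qed

lemma abs_cos_diff_le: "\<bar>cos a - cos b\<bar> \<le> \<bar>a - b\<bar>" for a b :: real
proof -
  have "\<bar>cos a - cos b\<bar> = 2 * \<bar>sin ((a + b) / 2)\<bar> * \<bar>sin ((b - a) / 2)\<bar>"
    by (simp add: cos_diff_cos abs_mult)
  also have "\<dots> \<le> 2 * 1 * \<bar>(b - a) / 2\<bar>"
    by (intro mult_mono abs_sin_x_le_abs_x) auto
  finally show ?thesis by simp
qed

lemma cone_norm_sq_ge:
  fixes \<alpha> \<beta> d :: real
  assumes "0 \<le> \<alpha>" "0 \<le> \<beta>"
  shows "(\<alpha> - \<beta>)\<^sup>2 \<le> \<alpha>\<^sup>2 + \<beta>\<^sup>2 + 2 * \<alpha> * \<beta> * cos d"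
proof -
  have "2 * \<alpha> * \<beta> * (-1) \<le> 2 * \<alpha> * \<beta> * cos d" using assms by (intro mult_left_mono) auto
  then show ?thesis by (simp add: power2_diff)
qed

text \<open>The triangle inequality in the Euclidean cone: the projections of two vectors of lengths
  \<open>\<alpha>\<close> and \<open>\<beta>\<close> to a third direction add up to at most the length of their sum.\<close>

lemma cone_triangle_ineq:
  fixes \<alpha> \<beta> r s d :: real
  assumes ab: "0 \<le> \<alpha>" "0 \<le> \<beta>" and r: "0 \<le> r" "r \<le> pi" and s: "0 \<le> s" "s \<le> pi"
    and d: "0 \<le> d" "d \<le> r + s"
  shows "\<alpha> * cos r + \<beta> * cos s \<le> sqrt (\<alpha>\<^sup>2 + \<beta>\<^sup>2 + 2 * \<alpha> * \<beta> * cos d)"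
proof (cases "r + s \<le> pi")
  case True
  then have "cos (r + s) \<le> cos d" using d by (intro cos_monotone_0_pi_le) auto
  then have "2 * \<alpha> * \<beta> * cos (r + s) \<le> 2 * \<alpha> * \<beta> * cos d" using ab by (intro mult_left_mono) auto
  \<comment> \<open>For planar vectors of lengths \<alpha> and \<beta> at angles \<open>r\<close>
    and \<open>- s\<close> from an axis, the two squares belong to the components of their sum along
    and across the axis.\<close>
  moreover have "(\<alpha> * cos r + \<beta> * cos s)\<^sup>2 + (\<alpha> * sin r - \<beta> * sin s)\<^sup>2
      = \<alpha>\<^sup>2 + \<beta>\<^sup>2 + 2 * \<alpha> * \<beta> * cos (r + s)"
    using sin_cos_squared_add[of r] sin_cos_squared_add[of s] unfolding cos_add by algebra
  moreover have "(\<alpha> * sin r - \<beta> * sin s)\<^sup>2 \<ge> 0" by simp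
  ultimately show ?thesis by (intro real_le_rsqrt) linarith
next
  case False
  have "\<bar>\<alpha> - \<beta>\<bar> \<le> sqrt (\<alpha>\<^sup>2 + \<beta>\<^sup>2 + 2 * \<alpha> * \<beta> * cos d)"
    using cone_norm_sq_ge[OF ab] by (intro real_le_rsqrt) simp
  \<comment> \<open>Here \<open>s > pi - r\<close>, so the second projection is at most
    \<open>- \<beta> * cos r\<close>.\<close>
  moreover have "\<alpha> * cos r + \<beta> * cos s \<le> \<bar>\<alpha> - \<beta>\<bar>"
  proof -
    have "cos s \<le> cos (pi - r)" using False r s by (intro cos_monotone_0_pi_le) auto
    then have sr: "cos s \<le> - cos r" by simp
    have mul: "(a - b) * cos q \<le> \<bar>a - b\<bar>" for a b q :: real
      using mult_mono[of "\<bar>a - b\<bar>" "\<bar>a - b\<bar>" "\<bar>cos q\<bar>" 1] abs_ge_self[of "(a - b) * cos q"]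
      by (simp add: abs_mult)
    have "\<alpha> * cos r + \<beta> * cos s \<le> (\<alpha> - \<beta>) * cos r"
      using mult_left_mono[OF sr ab(2)] by (simp add: algebra_simps)
    also have "\<dots> \<le> \<bar>\<alpha> - \<beta>\<bar>" by (rule mul)
    finally show ?thesis .
  qed
  ultimately show ?thesis by linarith
qed

section \<open>Ultrafilters and their limits\<close>

text \<open>Compactness gives a cluster point of the image filter. An ultrafilter decides for each
  neighbourhood whether it contains \<open>f i\<close>, so it converges to that point.\<close>

lemma ultrafilter_tendsto_compact:
  fixes f :: "'i \<Rightarrow> 'b::topological_space"
  assumes \<omega>: "ultrafilter \<omega>" and K: "compact K" and f: "\<And>i. f i \<in> K"
  obtains l where "l \<in> K" "(f \<longlongrightarrow> l) \<omega>"
proof -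
  have "filtermap f \<omega> \<noteq> bot" "eventually (\<lambda>x. x \<in> K) (filtermap f \<omega>)"
    using \<omega> f by (auto simp: ultrafilter_def filtermap_bot_iff eventually_filtermap)
  then obtain l where l: "l \<in> K" and nb: "inf (nhds l) (filtermap f \<omega>) \<noteq> bot"
    using K unfolding compact_filter by blast
  have "eventually (\<lambda>i. f i \<in> S) \<omega>" if S: "open S" "l \<in> S" for S
  proof (rule ccontr)
    assume "\<not> eventually (\<lambda>i. f i \<in> S) \<omega>"
    then have "eventually (\<lambda>i. f i \<notin> S) \<omega>" using \<omega> by (auto simp: ultrafilter_def)
    then have "eventually (\<lambda>x. x \<notin> S) (filtermap f \<omega>)" by (simp add: eventually_filtermap)
    moreover have "eventually (\<lambda>x. x \<in> S) (nhds l)" using S by (auto simp: eventually_nhds)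
    ultimately have "eventually (\<lambda>x. False) (inf (nhds l) (filtermap f \<omega>))"
      unfolding eventually_inf by blast
    then show False using nb by (simp add: trivial_limit_def)
  qed
  then have "(f \<longlongrightarrow> l) \<omega>" by (simp add: tendsto_def)
  with l show ?thesis by (rule that)
qed

text \<open>Zorn's lemma gives a minimal proper filter below \<open>sequentially\<close>.
  Restricting it to \<open>P\<close> yields the improper filter or the filter itself, so it decides
  \<open>P\<close>; lying below \<open>sequentially\<close> excludes principal filters.\<close>

lemma nonprincipal_ultrafilter_exists: "\<exists>\<omega>. nonprincipal_ultrafilter \<omega>"
proof -
  define A :: "nat filter set" where "A = {F. F \<noteq> bot \<and> F \<le> sequentially}"
  have seqA: "sequentially \<in> A" by (simp add: A_def)
  have "\<exists>m\<in>A. \<forall>F\<in>A. F \<le> m \<longrightarrow> F = m"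
  proof (rule predicate_Zorn)
    show "partial_order_on A (relation_of (\<lambda>F G. G \<le> F) A)"
      by (auto simp: relation_of_def partial_order_on_def preorder_on_def
          refl_on_def trans_def antisym_def)
    fix C assume C: "C \<in> Chains (relation_of (\<lambda>F G. G \<le> F) A)"
    show "\<exists>u\<in>A. \<forall>a\<in>C. u \<le> a"
    proof (cases "C = {}")
      case True
      then show ?thesis using seqA by blast
    next
      case False
      have CA: "C \<subseteq> A" using C by (rule Chains_relation_of)
      have lin: "F \<le> G \<or> G \<le> F" if "F \<in> C" "G \<in> C" for F G
        using C that by (auto simp: Chains_def relation_of_def)
      \<comment> \<open>A chain is directed downwards, so its infimum is improper only if a member
        already is.\<close>
      have "eventually (\<lambda>_. False) (Inf C) \<longleftrightarrow> (\<exists>F\<in>C. eventually (\<lambda>_. False) F)"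
      proof (rule eventually_Inf_base[OF False])
        fix F G assume "F \<in> C" "G \<in> C"
        then show "\<exists>x\<in>C. x \<le> inf F G" using lin[of F G] by auto
      qed
      then have "Inf C \<noteq> bot" using CA by (auto simp: A_def trivial_limit_def)
      moreover have "Inf C \<le> sequentially"
        using False CA by (auto simp: A_def intro: Inf_lower2)
      ultimately show ?thesis by (auto simp: A_def intro!: bexI[of _ "Inf C"] Inf_lower)
    qed
  qed
  then obtain \<omega> where \<omega>: "\<omega> \<in> A" and min: "\<And>F. F \<in> A \<Longrightarrow> F \<le> \<omega> \<Longrightarrow> F = \<omega>" by blast
  have "eventually P \<omega> \<or> eventually (\<lambda>n. \<not> P n) \<omega>" for P
  proof (cases "inf \<omega> (principal {n. P n}) = bot")
    case True
    then have "eventually (\<lambda>_. False) (inf \<omega> (principal {n. P n}))" by simp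
    then show ?thesis by (simp add: eventually_inf_principal)
  next
    case False
    then have "inf \<omega> (principal {n. P n}) \<in> A" using \<omega> by (auto simp: A_def intro: le_infI1)
    then have "inf \<omega> (principal {n. P n}) = \<omega>" by (rule min) simp
    moreover have "eventually P (inf \<omega> (principal {n. P n}))" by (simp add: eventually_inf_principal)
    ultimately show ?thesis by simp
  qed
  then have "ultrafilter \<omega>" using \<omega> by (simp add: ultrafilter_def A_def)
  moreover have "\<omega> \<noteq> principal {n}" for n
  proof
    assume "\<omega> = principal {n}"
    then have "principal {n} \<le> sequentially" using \<omega> by (simp add: A_def)
    then have "eventually (\<lambda>k. n < k) (principal {n})"
      using eventually_gt_at_top filter_leD by blast
    then show False by (simp add: eventually_principal)
  qed
  ultimately show ?thesis by (auto simp: nonprincipal_ultrafilter_def)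
qed

section \<open>Comparison geometry of \<open>U\<close> and of its Euclidean cone\<close>

locale cat1_ball =
  fixes U :: "'a::metric_space set" and p :: 'a
  assumes complete: "complete U" and CAT1: "CAT1 U" and p: "p \<in> U"
    and ball: "\<And>x. x \<in> U \<Longrightarrow> dist p x \<le> pi / 2"
begin

lemma dist_le_pi: "x \<in> U \<Longrightarrow> y \<in> U \<Longrightarrow> dist x y \<le> pi"
  using ball[of x] ball[of y] dist_triangle3[of x y p] by simp

lemma cos_center_nonneg: "x \<in> U \<Longrightarrow> 0 \<le> cos (dist p x)"
  using ball[of x] by (intro cos_ge_zero) (auto intro: order_trans[of _ 0])

text \<open>Triangles of perimeter at least \<open>2\<pi>\<close> have no comparison triangle; for them the diameter bound
  \<open>\<pi>\<close> and the triangle inequality give the same estimate.\<close>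

lemma cos_dist_geodesic_ge:
  assumes u: "u \<in> U" and v: "v \<in> U" and z: "z \<in> U" and l0: "0 < dist u v" and lpi: "dist u v < pi"
    and geo: "geodesic_in U \<gamma> u v" and t: "0 \<le> t" "t \<le> dist u v"
  shows "cos (dist z u) * sin (dist u v - t) + cos (dist z v) * sin t
           \<le> sin (dist u v) * cos (dist z (\<gamma> t))"
proof -
  define l r s d where "l = dist u v" and "r = dist z u" and "s = dist z v" and "d = dist z (\<gamma> t)"
  note defs = l_def r_def s_def d_def
  have l: "0 < l" "l < pi" "t \<le> l" using l0 lpi t by (simp_all add: l_def)
  have sl: "sin l > 0" and st: "sin t \<ge> 0" and slt: "sin (l - t) \<ge> 0"
    using l t by (auto intro!: sin_gt_zero sin_ge_zero)
  have geo': "\<gamma> 0 = u" "\<gamma> l = v" "\<forall>s\<in>{0..l}. \<gamma> s \<in> U"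
    "\<forall>s\<in>{0..l}. \<forall>t\<in>{0..l}. dist (\<gamma> s) (\<gamma> t) = \<bar>s - t\<bar>"
    using geo unfolding geodesic_in_def l_def by blast+
  have "dist (\<gamma> 0) (\<gamma> t) = \<bar>0 - t\<bar>" "dist (\<gamma> l) (\<gamma> t) = \<bar>l - t\<bar>" "\<gamma> t \<in> U"
    using geo'(3,4) t l by auto
  then have g: "\<gamma> t \<in> U" "dist u (\<gamma> t) = t" "dist v (\<gamma> t) = l - t"
    using geo'(1,2) t l by auto
  have bd: "0 \<le> r" "r \<le> pi" "0 \<le> s" "s \<le> pi" "0 \<le> d" "d \<le> pi"
    using dist_le_pi u v z g by (auto simp: defs)
  have d1: "d \<le> r + t" using dist_triangle[of z "\<gamma> t" u] g by (simp add: defs)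
  have d2: "d \<le> s + (l - t)" using dist_triangle[of z "\<gamma> t" v] g by (simp add: defs)
  have tri: "l \<le> r + s" "r \<le> l + s" "s \<le> l + r"
    using dist_triangle[of u v z] dist_triangle[of z u v] dist_triangle[of z v u]
    by (simp_all add: defs dist_commute add.commute)
  have "cos r * sin (l - t) + cos s * sin t \<le> sin l * cos d"
  proof (cases "l + r + s < 2 * pi")
    case True
    obtain x' y' z' where S: "x' \<in> S2" "y' \<in> S2" "z' \<in> S2"
      and ip: "x' \<bullet> y' = cos l" "x' \<bullet> z' = cos r" "y' \<bullet> z' = cos s"
      using comparison_triangle_exists[OF l(1,2) bd(1-4) tri True] by blast
    have one: "x' \<bullet> x' = 1" "y' \<bullet> y' = 1" using S by (auto simp: S2_def norm_eq_1)
    \<comment> \<open>The point at distance \<open>t\<close> from \<open>x'\<close> on the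
      great-circle arc to \<open>y'\<close>.\<close>
    define q where "q = (sin (l - t) / sin l) *\<^sub>R x' + (sin t / sin l) *\<^sub>R y'"
    have xq: "x' \<bullet> q = cos t"
    proof -
      have "x' \<bullet> q = (sin (l - t) + sin t * cos l) / sin l"
        by (simp add: q_def inner_add_right one ip add_divide_distrib)
      also have "sin (l - t) + sin t * cos l = cos t * sin l" by (simp add: sin_diff)
      finally show ?thesis using sl by simp
    qed
    have qy: "q \<bullet> y' = cos (l - t)"
    proof -
      have "q \<bullet> y' = (sin (l - t) * cos l + sin t) / sin l"
        by (simp add: q_def inner_add_left one ip add_divide_distrib)
      also have "sin t = sin (l - (l - t))" by simp
      also have "sin (l - t) * cos l + sin (l - (l - t)) = cos (l - t) * sin l"
        by (simp only: sin_diff[of l "l - t"]) (simp add: algebra_simps)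
      finally show ?thesis using sl by simp
    qed
    have "q \<bullet> q = (sin (l - t) / sin l) * (x' \<bullet> q) + (sin t / sin l) * (q \<bullet> y')"
      by (simp add: q_def inner_add_left inner_commute)
    also have "\<dots> = (sin (l - t) * cos t + cos (l - t) * sin t) / sin l"
      by (simp add: xq qy add_divide_distrib mult.commute)
    also have "\<dots> = sin ((l - t) + t) / sin l" by (simp only: sin_add)
    finally have qq: "q \<bullet> q = 1" using sl by simp
    then have qS: "q \<in> S2" by (simp add: S2_def norm_eq_1)
    have zq: "z' \<bullet> q = (cos r * sin (l - t) + cos s * sin t) / sin l"
      using ip by (simp add: q_def inner_add_right inner_commute add_divide_distrib mult.commute)
    have "dist z (\<gamma> t) \<le> sdist z' q"
    proof -
      have "geodesic_in U \<gamma> u v \<and> dist u v + dist v z + dist z u < 2 * pi \<and>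
        0 \<le> t \<and> t \<le> dist u v \<and> x' \<in> S2 \<and> y' \<in> S2 \<and> z' \<in> S2 \<and> q \<in> S2 \<and>
        sdist x' y' = dist u v \<and> sdist y' z' = dist v z \<and> sdist z' x' = dist z u \<and>
        sdist x' q = t \<and> sdist q y' = dist u v - t"
        using geo True t S qS ip xq qy l bd tri
        by (simp add: sdist_def defs[symmetric] dist_commute[of v z] inner_commute[of z' x'] arccos_cos)
      then show ?thesis using CAT1 u v z unfolding CAT1_def by blast
    qed
    moreover have "\<bar>z' \<bullet> q\<bar> \<le> 1"
      using Cauchy_Schwarz_ineq2[of z' q] S qS by (simp add: S2_def)
    ultimately have "cos (sdist z' q) \<le> cos d" "cos (sdist z' q) = z' \<bullet> q"
      unfolding sdist_def d_def abs_le_iff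
      by (intro cos_monotone_0_pi_le arccos_ubound cos_arccos zero_le_dist; simp)+
    then show ?thesis using zq sl by (simp add: field_simps)
  next
    case False
    \<comment> \<open>If \<open>r + t \<le> pi\<close>, the perimeter gives
      \<open>s \<ge> 2 * pi - (l + r)\<close>, and the addition formulas then produce
      \<open>cos (r + t)\<close>; the second case is symmetric. If both sums exceed pi, the left
      side is at most \<open>- sin l\<close>.\<close>
    consider "r + t \<le> pi" | "s + (l - t) \<le> pi" | "r + t > pi" "s + (l - t) > pi" by linarith
    then show ?thesis
    proof cases
      case 1
      have "cos s \<le> cos (2 * pi - (l + r))"
        using False bd l by (intro cos_monotone_0_pi_le) auto
      then have "cos s \<le> cos (l + r)" by (simp add: cos_diff)
      then have "cos r * sin (l - t) + cos s * sin t \<le> cos r * sin (l - t) + cos (l + r) * sin t"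
        using st by (simp add: mult_right_mono)
      also have "\<dots> = sin l * cos (r + t)" by (simp add: sin_diff cos_add algebra_simps)
      also have "\<dots> \<le> sin l * cos d"
        using sl d1 1 bd by (intro mult_left_mono cos_monotone_0_pi_le) auto
      finally show ?thesis .
    next
      case 2
      define w where "w = l - t"
      have "cos r \<le> cos (2 * pi - (l + s))"
        using False bd l by (intro cos_monotone_0_pi_le) auto
      then have "cos r \<le> cos (l + s)" by (simp add: cos_diff)
      then have "cos r * sin w + cos s * sin (l - w) \<le> cos (l + s) * sin w + cos s * sin (l - w)"
        using slt by (simp add: mult_right_mono w_def)
      also have "\<dots> = sin l * cos (s + w)" by (simp add: sin_diff cos_add algebra_simps)
      also have "\<dots> \<le> sin l * cos d"
        using sl d2 2 bd by (intro mult_left_mono cos_monotone_0_pi_le) (auto simp: w_def)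
      finally show ?thesis by (simp add: w_def)
    next
      case 3
      have "cos r \<le> cos (pi - t)" "cos s \<le> cos (pi - (l - t))"
        using 3 bd t l by (intro cos_monotone_0_pi_le; simp)+
      then have "cos r \<le> - cos t" "cos s \<le> - cos (l - t)" by simp_all
      then have "cos r * sin (l - t) + cos s * sin t \<le> (- cos t) * sin (l - t) + (- cos (l - t)) * sin t"
        using st slt by (intro add_mono mult_right_mono)
      also have "\<dots> = - sin ((l - t) + t)" by (simp only: sin_add) (simp add: algebra_simps)
      also have "\<dots> \<le> sin l * cos d" using sl mult_left_mono[of "-1" "cos d" "sin l"] by simp
      finally show ?thesis .
    qed
  qed
  then show ?thesis by (simp add: defs)
qed

text \<open>The point \<open>m\<close> is the direction of the sum of \<open>\<alpha>u\<close> and \<open>\<beta>v\<close> in the Euclidean cone over \<open>U\<close>.\<close>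

lemma cone_interpolation:
  assumes u: "u \<in> U" and v: "v \<in> U" and d: "dist u v < pi" and ab: "0 < \<alpha>" "0 < \<beta>"
  obtains m where "m \<in> U" "\<And>z. z \<in> U \<Longrightarrow> \<alpha> * cos (dist z u) + \<beta> * cos (dist z v)
      \<le> sqrt (\<alpha>\<^sup>2 + \<beta>\<^sup>2 + 2 * \<alpha> * \<beta> * cos (dist u v)) * cos (dist z m)"
proof (cases "u = v")
  case True
  have "sqrt (\<alpha>\<^sup>2 + \<beta>\<^sup>2 + 2 * \<alpha> * \<beta>) = \<alpha> + \<beta>"
    using ab by (intro real_sqrt_unique) (auto simp: power2_sum)
  then show ?thesis using True that[of u] u by (simp add: algebra_simps)
next
  case False
  define l n where "l = dist u v" and "n = sqrt (\<alpha>\<^sup>2 + \<beta>\<^sup>2 + 2 * \<alpha> * \<beta> * cos l)"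
  have l: "0 < l" "l < pi" using False d by (auto simp: l_def)
  have sl: "sin l > 0" using l by (simp add: sin_gt_zero)
  \<comment> \<open>With \<open>u\<close> along the first axis of a plane, the sum has coordinates
    \<open>\<alpha> + \<beta> * cos l\<close> and \<open>\<beta> * sin l\<close>; \<open>n\<close>
    is its length, and \<open>t\<close> below is its angle to \<open>u\<close>.\<close>
  have sq: "\<alpha>\<^sup>2 + \<beta>\<^sup>2 + 2 * \<alpha> * \<beta> * cos l = (\<alpha> + \<beta> * cos l)\<^sup>2 + (\<beta> * sin l)\<^sup>2"
    using sin_cos_squared_add[of l] by algebra
  have "(\<beta> * sin l)\<^sup>2 > 0" using ab sl by simp
  then have n0: "n > 0" unfolding n_def sq by (intro real_sqrt_gt_zero add_nonneg_pos) auto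
  have n2: "n\<^sup>2 = (\<alpha> + \<beta> * cos l)\<^sup>2 + (\<beta> * sin l)\<^sup>2" unfolding n_def sq by simp
  define t where "t = arccos ((\<alpha> + \<beta> * cos l) / n)"
  have "\<bar>\<alpha> + \<beta> * cos l\<bar> \<le> n" using n0 n2 by (metis abs_le_square_iff abs_of_pos le_add_same_cancel1 zero_le_power2)
  then have bd: "\<bar>(\<alpha> + \<beta> * cos l) / n\<bar> \<le> 1" using n0 by simp
  then have t: "0 \<le> t" "t \<le> pi" and ct: "cos t = (\<alpha> + \<beta> * cos l) / n"
    unfolding t_def abs_le_iff by (auto intro!: arccos_lbound arccos_ubound cos_arccos simp del: abs_divide)
  have "(n * sin t)\<^sup>2 = n\<^sup>2 - (n * cos t)\<^sup>2" using sin_cos_squared_add[of t] by algebra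
  also have "n * cos t = \<alpha> + \<beta> * cos l" using ct n0 by simp
  finally have "(n * sin t)\<^sup>2 = (\<beta> * sin l)\<^sup>2" using n2 by simp
  then have nst: "n * sin t = \<beta> * sin l"
    using n0 t sl ab by (simp add: power2_eq_iff_nonneg sin_ge_zero)
  have nct: "n * cos t = \<alpha> + \<beta> * cos l" using ct n0 by simp
  \<comment> \<open>Together with \<open>nst\<close>, this makes the sine weights of the geodesic
    inequality proportional to \<alpha> and \<beta>.\<close>
  have nslt: "n * sin (l - t) = \<alpha> * sin l"
  proof -
    have "n * sin (l - t) = sin l * (n * cos t) - cos l * (n * sin t)" by (simp add: sin_diff algebra_simps)
    then show ?thesis unfolding nst nct by (simp add: algebra_simps)
  qed
  have tl: "t \<le> l"
  proof (rule ccontr)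
    assume "\<not> t \<le> l"
    then have "sin (t - l) > 0" using t l by (intro sin_gt_zero) auto
    then have "n * sin (l - t) < 0" using n0 by (metis minus_diff_eq mult_pos_neg neg_less_0_iff_less sin_minus)
    then show False using nslt ab sl by (simp add: mult_less_0_iff)
  qed
  obtain \<gamma> where \<gamma>: "geodesic_in U \<gamma> u v" using CAT1 u v d unfolding CAT1_def by blast
  have "\<alpha> * cos (dist z u) + \<beta> * cos (dist z v) \<le> n * cos (dist z (\<gamma> t))" if z: "z \<in> U" for z
  proof -
    have "cos (dist z u) * sin (l - t) + cos (dist z v) * sin t \<le> sin l * cos (dist z (\<gamma> t))"
      using cos_dist_geodesic_ge[OF u v z _ d \<gamma> t(1)] tl l by (simp add: l_def)
    then have "n * (cos (dist z u) * sin (l - t) + cos (dist z v) * sin t) \<le> n * (sin l * cos (dist z (\<gamma> t)))"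
      using n0 by simp
    also have "n * (cos (dist z u) * sin (l - t) + cos (dist z v) * sin t)
        = cos (dist z u) * (n * sin (l - t)) + cos (dist z v) * (n * sin t)" by (simp add: algebra_simps)
    also have "\<dots> = sin l * (\<alpha> * cos (dist z u) + \<beta> * cos (dist z v))"
      unfolding nst nslt by (simp add: algebra_simps)
    finally have "sin l * (\<alpha> * cos (dist z u) + \<beta> * cos (dist z v)) \<le> sin l * (n * cos (dist z (\<gamma> t)))"
      by (simp add: mult_ac)
    then show ?thesis using sl by simp
  qed
  moreover have "\<gamma> t \<in> U" using \<gamma> t tl unfolding geodesic_in_def l_def by auto
  ultimately show ?thesis using that[of "\<gamma> t"] unfolding n_def l_def by blast
qed

text \<open>In the Euclidean cone over \<open>U\<close>, which is CAT(0), this says that the squared diagonals of the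
  quadrilateral \<open>\<alpha>x\<close>, \<open>\<alpha>a\<close>, \<open>\<beta>b\<close>, \<open>\<beta>y\<close> add up to at most the sum of its squared sides; the point
  \<open>m\<close> in the proof is the direction of the midpoint of \<open>\<alpha>a\<close> and \<open>\<beta>y\<close>.\<close>

lemma cone_quadrilateral:
  assumes U: "x \<in> U" "y \<in> U" "a \<in> U" "b \<in> U" and d: "dist a y < pi" and ab: "0 < \<alpha>" "0 < \<beta>"
  shows "\<alpha>\<^sup>2 * cos (dist x a) + \<beta>\<^sup>2 * cos (dist y b) + \<alpha> * \<beta> * (cos (dist a b) + cos (dist x y))
    \<le> \<alpha>\<^sup>2 + \<beta>\<^sup>2 + \<alpha> * \<beta> * (cos (dist x b) + cos (dist y a))"
proof -
  obtain m where m: "m \<in> U" and mz: "\<And>z. z \<in> U \<Longrightarrow> \<alpha> * cos (dist z a) + \<beta> * cos (dist z y)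
      \<le> sqrt (\<alpha>\<^sup>2 + \<beta>\<^sup>2 + 2 * \<alpha> * \<beta> * cos (dist a y)) * cos (dist z m)"
    using cone_interpolation[OF U(3,2) d ab] by blast
  \<comment> \<open>The cone lengths of the sums of \<alpha>a and \<beta>y, and of \<alpha>x and
    \<beta>b. Passing through \<open>m\<close> bounds the product of the two sums by
    \<open>D * E\<close>, hence by half of \<open>D\<^sup>2 + E\<^sup>2\<close>.\<close>
  define D E where "D = sqrt (\<alpha>\<^sup>2 + \<beta>\<^sup>2 + 2 * \<alpha> * \<beta> * cos (dist a y))"
    and "E = sqrt (\<alpha>\<^sup>2 + \<beta>\<^sup>2 + 2 * \<alpha> * \<beta> * cos (dist x b))"
  have pos: "0 \<le> \<alpha>\<^sup>2 + \<beta>\<^sup>2 + 2 * \<alpha> * \<beta> * cos q" for q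
    using cone_norm_sq_ge[of \<alpha> \<beta> q] ab by (intro order_trans[OF zero_le_power2]) auto
  have D2: "D\<^sup>2 = \<alpha>\<^sup>2 + \<beta>\<^sup>2 + 2 * \<alpha> * \<beta> * cos (dist a y)" and E2: "E\<^sup>2 = \<alpha>\<^sup>2 + \<beta>\<^sup>2 + 2 * \<alpha> * \<beta> * cos (dist x b)"
    and D0: "D \<ge> 0" using pos by (simp_all add: D_def E_def)
  have "\<alpha> * cos (dist x m) + \<beta> * cos (dist b m) \<le> E"
    unfolding E_def using U m ab dist_triangle2[of x b m] dist_le_pi
    by (intro cone_triangle_ineq) auto
  then have "D * (\<alpha> * cos (dist x m) + \<beta> * cos (dist b m)) \<le> D * E" using D0 by (rule mult_left_mono)
  moreover have "\<alpha> * (\<alpha> * cos (dist x a) + \<beta> * cos (dist x y)) \<le> \<alpha> * (D * cos (dist x m))"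
    "\<beta> * (\<alpha> * cos (dist b a) + \<beta> * cos (dist b y)) \<le> \<beta> * (D * cos (dist b m))"
    using mz[OF U(1)] mz[OF U(4)] ab by (simp_all add: D_def)
  moreover have "2 * (D * E) \<le> D\<^sup>2 + E\<^sup>2" using sum_squares_bound[of D E] by (simp add: mult.assoc)
  ultimately show ?thesis unfolding D2 E2
    by (simp add: algebra_simps power2_eq_square dist_commute[of b] dist_commute[of y a])
qed

end

section \<open>Ultralimits of cosines and distances\<close>

locale cat1_ball_ultrafilter = cat1_ball +
  fixes \<omega> :: "nat filter"
  assumes ultra: "ultrafilter \<omega>"
begin

lemma nontrivial: "\<omega> \<noteq> bot"
  using ultra by (simp add: ultrafilter_def)

text \<open>For \<open>x\<close> and \<open>u\<close> in \<open>U\<close>, the cosine of the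
  distance in the ultracompletion from \<open>x\<close> to the constant sequence \<open>u\<close>.
  Cosines are bounded, so the limit exists for every sequence.\<close>

definition ucos :: "(nat \<Rightarrow> 'a) \<Rightarrow> 'a \<Rightarrow> real" where
  "ucos x u = Lim \<omega> (\<lambda>n. cos (dist (x n) u))"

lemma tendsto_ucos: "((\<lambda>n. cos (dist (x n) u)) \<longlongrightarrow> ucos x u) \<omega>"
proof -
  obtain l where "((\<lambda>n. cos (dist (x n) u)) \<longlongrightarrow> l) \<omega>"
    by (rule ultrafilter_tendsto_compact[OF ultra compact_Icc[of "-1" "1::real"], of "\<lambda>n. cos (dist (x n) u)"]) auto
  then show ?thesis unfolding ucos_def by (simp add: tendsto_Lim[OF nontrivial])
qed

lemma tendsto_ultra_dist:
  assumes "\<And>n. x n \<in> U" "\<And>n. y n \<in> U"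
  shows "((\<lambda>n. dist (x n) (y n)) \<longlongrightarrow> ultra_dist \<omega> x y) \<omega>" "ultra_dist \<omega> x y \<in> {0..pi}"
proof -
  obtain l where l: "l \<in> {0..pi}" "((\<lambda>n. dist (x n) (y n)) \<longlongrightarrow> l) \<omega>"
    by (rule ultrafilter_tendsto_compact[OF ultra compact_Icc[of 0 pi], of "\<lambda>n. dist (x n) (y n)"])
      (use assms dist_le_pi in auto)
  then show "((\<lambda>n. dist (x n) (y n)) \<longlongrightarrow> ultra_dist \<omega> x y) \<omega>" "ultra_dist \<omega> x y \<in> {0..pi}"
    unfolding ultra_dist_def by (simp_all add: tendsto_Lim[OF nontrivial])
qed

lemma ucos_le_1: "ucos x u \<le> 1"
  by (rule tendsto_upperbound[OF tendsto_ucos _ nontrivial]) simp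

lemma ucos_lipschitz: "ucos x u \<le> ucos x v + dist u v"
proof (rule tendsto_le[OF nontrivial _ tendsto_ucos])
  show "((\<lambda>n. cos (dist (x n) v) + dist u v) \<longlongrightarrow> ucos x v + dist u v) \<omega>"
    by (intro tendsto_intros tendsto_ucos)
  have "cos (dist (x n) u) \<le> cos (dist (x n) v) + dist u v" for n
    using abs_cos_diff_le[of "dist (x n) u" "dist (x n) v"] abs_dist_diff_le[of u "x n" v]
    by (simp add: dist_commute)
  then show "\<forall>\<^sub>F n in \<omega>. cos (dist (x n) u) \<le> cos (dist (x n) v) + dist u v" by simp
qed

lemma ucos_center_nonneg:
  assumes "\<And>n. x n \<in> U"
  shows "0 \<le> ucos x p"
proof (rule tendsto_lowerbound[OF tendsto_ucos _ nontrivial])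
  show "\<forall>\<^sub>F n in \<omega>. 0 \<le> cos (dist (x n) p)" using cos_center_nonneg[OF assms] by (simp add: dist_commute)
qed

text \<open>A substitute for concavity at distance pi, where no geodesic need exist: the distances
  from \<open>x n\<close> to \<open>u\<close> and \<open>v\<close> add up to at least pi.\<close>

lemma ucos_antipodal:
  assumes x: "\<And>n. x n \<in> U" and uv: "u \<in> U" "v \<in> U" "dist u v = pi"
  shows "ucos x u + ucos x v \<le> 0"
proof (rule tendsto_upperbound[OF tendsto_add[OF tendsto_ucos tendsto_ucos] _ nontrivial])
  have "cos (dist (x n) u) + cos (dist (x n) v) \<le> 0" for n
  proof -
    have "cos (dist (x n) u) \<le> cos (pi - dist (x n) v)"
      using dist_triangle3[of u v "x n"] uv dist_le_pi[OF x uv(1), of n] dist_le_pi[OF x uv(2), of n]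
      by (intro cos_monotone_0_pi_le) auto
    then show ?thesis by simp
  qed
  then show "\<forall>\<^sub>F n in \<omega>. cos (dist (x n) u) + cos (dist (x n) v) \<le> 0" by simp
qed

text \<open>The triangle inequality through \<open>p\<close> is tight, so both points lie at
  distance pi/2 from \<open>p\<close>.\<close>

lemma antipodal_cos_center:
  assumes "u \<in> U" "v \<in> U" "dist u v = pi"
  shows "cos (dist p u) = 0"
proof -
  have "dist p u = pi / 2" using ball[OF assms(1)] ball[OF assms(2)] dist_triangle3[of u v p] assms by linarith
  then show ?thesis by (simp only: cos_pi_half)
qed

section \<open>Support points and the retraction they define\<close>

lemma support_point_exists:
  assumes x: "\<And>n. x n \<in> U"
  shows "\<exists>a\<in>U. \<exists>c\<ge>0. ucos x a + c * cos (dist p a) = 1 \<and>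
    (\<forall>u\<in>U. ucos x u + c * cos (dist p u) \<le> cos (dist a u))"
proof -
  define h where "h u = cos (dist p u)" for u
  have h: "0 \<le> h u" "h u \<le> 1" if "u \<in> U" for u
    using cos_center_nonneg[OF that] by (auto simp: h_def)
  define C where "C = {c. 0 \<le> c \<and> (\<forall>u\<in>U. ucos x u + c * h u \<le> 1)}"
  define c where "c = Sup C"
  have C0: "0 \<in> C" using ucos_le_1 by (simp add: C_def)
  have "c' \<le> 1" if "c' \<in> C" for c'
  proof -
    have "ucos x p + c' * h p \<le> 1" using that p by (simp add: C_def)
    then show ?thesis using ucos_center_nonneg[of x, OF x] by (simp add: h_def)
  qed
  then have bdd: "bdd_above C" by (rule bdd_aboveI)
  have c0: "0 \<le> c" unfolding c_def using C0 bdd by (rule cSup_upper)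
  define H where "H u = ucos x u + c * h u" for u
  have H1: "H u \<le> 1" if u: "u \<in> U" for u
  proof (cases "h u = 0")
    case True
    then show ?thesis using ucos_le_1 by (simp add: H_def)
  next
    case False
    then have hu: "h u > 0" using h[OF u] by simp
    have "c \<le> (1 - ucos x u) / h u"
      unfolding c_def using C0 hu u by (intro cSup_least) (auto simp: C_def field_simps)
    then show ?thesis using hu by (simp add: H_def field_simps)
  qed
  \<comment> \<open>The larger coefficient \<open>c + e\<close> fails at some \<open>u\<close>, and
    since \<open>h u \<le> 1\<close> the increase accounts for at most \<open>e\<close>.\<close>
  have near: "\<exists>u\<in>U. 1 - e < H u" if e: "0 < e" for e
  proof -
    have "c + e \<notin> C" using cSup_upper[OF _ bdd, of "c + e"] e by (auto simp: c_def)
    then obtain u where u: "u \<in> U" "1 < ucos x u + (c + e) * h u"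
      using c0 e by (auto simp: C_def not_le)
    have "e * h u \<le> e" using h[OF u(1)] e by (simp add: mult_left_le)
    then show ?thesis using u by (intro bexI[of _ u]) (auto simp: H_def algebra_simps)
  qed
  have Hlip: "H u \<le> H v + (1 + c) * dist u v" for u v
  proof -
    have "h u \<le> h v + dist u v"
      using abs_cos_diff_le[of "dist p u" "dist p v"] abs_dist_diff_le[of u p v]
      by (simp add: h_def dist_commute)
    then have "c * h u \<le> c * (h v + dist u v)" using c0 by (rule mult_left_mono)
    then show ?thesis using ucos_lipschitz[of x u v] by (simp add: H_def algebra_simps)
  qed
  \<comment> \<open>Interpolation at each \<open>x n\<close> and at \<open>p\<close> bounds the left
    side by \<open>D * H m\<close>, and \<open>H m \<le> 1\<close>.\<close>
  have conc: "\<alpha> * H u + \<beta> * H v \<le> sqrt (\<alpha>\<^sup>2 + \<beta>\<^sup>2 + 2 * \<alpha> * \<beta> * cos (dist u v))"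
    if U: "u \<in> U" "v \<in> U" and d: "dist u v < pi" and ab: "0 < \<alpha>" "0 < \<beta>" for u v \<alpha> \<beta>
  proof -
    define D where "D = sqrt (\<alpha>\<^sup>2 + \<beta>\<^sup>2 + 2 * \<alpha> * \<beta> * cos (dist u v))"
    obtain m where m: "m \<in> U" and mz: "\<And>z. z \<in> U \<Longrightarrow> \<alpha> * cos (dist z u) + \<beta> * cos (dist z v) \<le> D * cos (dist z m)"
      using cone_interpolation[OF U d ab] unfolding D_def by blast
    have "\<alpha> * ucos x u + \<beta> * ucos x v \<le> D * ucos x m"
    proof (rule tendsto_le[OF nontrivial])
      show "((\<lambda>n. D * cos (dist (x n) m)) \<longlongrightarrow> D * ucos x m) \<omega>"
        "((\<lambda>n. \<alpha> * cos (dist (x n) u) + \<beta> * cos (dist (x n) v)) \<longlongrightarrow> \<alpha> * ucos x u + \<beta> * ucos x v) \<omega>"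
        by (intro tendsto_intros tendsto_ucos)+
    qed (simp add: mz x)
    moreover have "c * (\<alpha> * h u + \<beta> * h v) \<le> c * (D * h m)"
      using mz[OF p] c0 unfolding h_def by (intro mult_left_mono) auto
    ultimately have "\<alpha> * H u + \<beta> * H v \<le> D * H m" by (simp add: H_def algebra_simps)
    also have "0 \<le> D"
      unfolding D_def using cone_norm_sq_ge[of \<alpha> \<beta>] ab
      by (intro real_sqrt_ge_zero order_trans[OF zero_le_power2]) auto
    then have "D * H m \<le> D" using H1[OF m] by (simp add: mult_left_le)
    finally show ?thesis by (simp add: D_def)
  qed
  have anti: "H u + H v \<le> 0" if "u \<in> U" "v \<in> U" "dist u v = pi" for u v
    using ucos_antipodal[of x, OF x that] antipodal_cos_center[OF that] antipodal_cos_center[of v u] that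
    by (simp add: H_def h_def dist_commute)
  \<comment> \<open>Equal weights in \<open>conc\<close>: the sum of two near-maximizers has length
    almost 2, so they are close. This makes a maximizing sequence Cauchy.\<close>
  have mid: "1 - 4 * e \<le> cos (dist u v)"
    if U: "u \<in> U" "v \<in> U" and e: "0 < e" "e < 1" and He: "1 - e < H u" "1 - e < H v" for u v e
  proof -
    have "dist u v \<noteq> pi" using anti[OF U] e He by linarith
    then have "dist u v < pi" using dist_le_pi[OF U] by simp
    then have "H u + H v \<le> sqrt (2 + 2 * cos (dist u v))" using conc[OF U, of 1 1] by simp
    moreover have "2 * (1 - e) \<le> H u + H v" using He by simp
    ultimately have "2 * (1 - e) \<le> sqrt (2 + 2 * cos (dist u v))" by (rule order_trans[rotated])
    moreover have "0 \<le> 2 + 2 * cos (dist u v)" using cos_ge_minus_one[of "dist u v"] by linarith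
    ultimately have "(2 * (1 - e))\<^sup>2 \<le> 2 + 2 * cos (dist u v)"
      using e by (metis power_mono real_sqrt_pow2 diff_ge_0_iff_ge less_imp_le mult_nonneg_nonneg zero_le_numeral)
    moreover have "(2 * (1 - e))\<^sup>2 = 4 - 8 * e + 4 * e\<^sup>2" by (simp add: power2_eq_square algebra_simps)
    ultimately show ?thesis using zero_le_power2[of e] by linarith
  qed
  \<comment> \<open>The shift by 2 keeps the error below 1, as \<open>mid\<close> requires.\<close>
  have "\<forall>k. \<exists>u\<in>U. 1 - 1 / real (k + 2) < H u" using near by simp
  then obtain w where w: "\<And>k. w k \<in> U" "\<And>k. 1 - 1 / real (k + 2) < H (w k)" by metis
  have "Cauchy w"
  proof (rule metric_CauchyI)
    fix e :: real assume e: "0 < e"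
    \<comment> \<open>Capping at pi keeps \<open>e'\<close> where cosine is decreasing.\<close>
    define e' where "e' = min e pi"
    have e': "0 < e'" "e' \<le> pi" "e' \<le> e" using e by (auto simp: e'_def)
    then have "cos e' < 1" using cos_monotone_0_pi[of 0 e'] by simp
    then obtain N :: nat where N: "inverse (real (Suc N)) < (1 - cos e') / 4"
      using reals_Archimedean[of "(1 - cos e') / 4"] by auto
    show "\<exists>M. \<forall>m\<ge>M. \<forall>n\<ge>M. dist (w m) (w n) < e"
    proof (intro exI allI impI)
      fix m n assume mn: "N \<le> m" "N \<le> n"
      define f where "f = 1 / real (N + 2)"
      have "f \<le> inverse (real (Suc N))" by (simp add: f_def field_simps)
      then have f: "0 < f" "f < 1" "f < (1 - cos e') / 4"
        using N by (auto simp: f_def)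
      have "1 / real (m + 2) \<le> f" "1 / real (n + 2) \<le> f"
        using mn by (auto simp: f_def intro!: divide_left_mono)
      then have "1 - 4 * f \<le> cos (dist (w m) (w n))"
        using w(2)[of m] w(2)[of n] by (intro mid w f) linarith+
      moreover have "cos e' < 1 - 4 * f" using f by simp
      ultimately have "cos e' < cos (dist (w m) (w n))" by (rule less_le_trans[rotated])
      then have "\<not> e' \<le> dist (w m) (w n)"
        using cos_monotone_0_pi_le[of e' "dist (w m) (w n)"] e' dist_le_pi[OF w(1) w(1)] by force
      then show "dist (w m) (w n) < e" using e' by linarith
    qed
  qed
  then obtain a where a: "a \<in> U" and lim: "w \<longlonglongrightarrow> a"
    using complete w(1) by (auto elim: completeE)
  have Ha: "H a = 1"
  proof (rule antisym[OF H1[OF a]])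
    have "(\<lambda>k. 1 - 1 / real (k + 2) - (1 + c) * dist (w k) a) \<longlonglongrightarrow> 1 - 0 - (1 + c) * dist a a"
      by (intro tendsto_intros lim LIMSEQ_ignore_initial_segment[OF lim_1_over_n])
    moreover have "1 - 1 / real (k + 2) - (1 + c) * dist (w k) a \<le> H a" for k
      using Hlip[of "w k" a] w(2)[of k] by linarith
    ultimately show "1 \<le> H a" by (intro LIMSEQ_le_const2[of _ 1]) auto
  qed
  have "H u \<le> cos (dist a u)" if u: "u \<in> U" for u
  proof (cases "dist a u = pi")
    case True
    then show ?thesis using anti[OF a u] Ha by simp
  next
    case False
    then have d: "dist a u < pi" using dist_le_pi[OF a u] by simp
    show ?thesis
    proof (rule ccontr)
      define q where "q = cos (dist a u)"
      assume "\<not> ?thesis"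
      then have gt: "q < H u" by (simp add: q_def)
      \<comment> \<open>Perturb the maximizer \<open>a\<close> by \<open>e\<close> times
        \<open>u\<close>. The first-order term violates \<open>conc\<close>;
        \<open>e \<le> H u - q\<close> keeps the second-order term too small to compensate, and
        \<open>e \<le> 1\<close> keeps \<open>1 + e * H u\<close> nonnegative for squaring.\<close>
      define e where "e = min 1 (H u - q)"
      have e: "0 < e" "e \<le> 1" "e \<le> H u - q" using gt by (auto simp: e_def)
      have Hu: "-1 < H u" "H u \<le> 1" using le_less_trans[OF cos_ge_minus_one gt[unfolded q_def]] H1[OF u] by auto
      have "1 + e * H u \<le> sqrt (1 + e\<^sup>2 + 2 * e * q)" using conc[OF a u d, of 1 e] e Ha by (simp add: q_def)
      moreover have "0 \<le> 1 + e * H u"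
        using e Hu mult_left_mono[of "-1" "H u" e] by simp
      ultimately have "(1 + e * H u)\<^sup>2 \<le> 1 + e\<^sup>2 + 2 * e * q"
        by (metis abs_of_nonneg real_sqrt_abs real_sqrt_le_iff)
      then have "e * (2 * (H u - q)) \<le> e * (e * (1 - (H u)\<^sup>2))"
        by (simp add: power2_eq_square algebra_simps)
      then have "2 * (H u - q) \<le> e * (1 - (H u)\<^sup>2)" using e by simp
      also have "\<dots> \<le> e * 1" using e by (intro mult_left_mono) auto
      finally show False using e by simp
    qed
  qed
  then show ?thesis using a c0 Ha unfolding H_def h_def by blast
qed

text \<open>The mixed terms of the quadrilateral inequality are bounded by \<open>au\<close> at
  \<open>b\<close> and \<open>bu\<close> at \<open>a\<close>. If \<open>cos (dist p a) = 0\<close>,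
  a weight degenerates, but then \<open>ucos x a = 1\<close>, so \<open>x\<close> is
  \<open>a\<close> itself in the ultracompletion; likewise for \<open>b\<close>.\<close>

lemma support_points_short:
  assumes x: "\<And>n. x n \<in> U" and y: "\<And>n. y n \<in> U" and ab: "a \<in> U" "b \<in> U"
    and a: "ucos x a + c * cos (dist p a) = 1"
    and au: "\<And>u. u \<in> U \<Longrightarrow> ucos x u + c * cos (dist p u) \<le> cos (dist a u)"
    and b: "ucos y b + c' * cos (dist p b) = 1"
    and bu: "\<And>u. u \<in> U \<Longrightarrow> ucos y u + c' * cos (dist p u) \<le> cos (dist b u)"
  shows "dist a b \<le> ultra_dist \<omega> x y"
proof -
  let ?L = "cos (ultra_dist \<omega> x y)"
  have lim: "((\<lambda>n. cos (dist (x n) (y n))) \<longlongrightarrow> ?L) \<omega>"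
    by (intro tendsto_intros tendsto_ultra_dist x y)
  \<comment> \<open>Such an \<open>x'\<close> is at ultradistance 0 from \<open>a'\<close>, so
    \<open>a'\<close> may replace it in the limit.\<close>
  have in_U: "lim \<le> ucos y' a'"
    if x': "\<And>n. x' n \<in> U" and a': "a' \<in> U" "ucos x' a' = 1"
      and l: "((\<lambda>n. cos (dist (x' n) (y' n))) \<longlongrightarrow> lim) \<omega>" for x' y' a' lim
  proof (rule tendsto_le[OF nontrivial _ l])
    let ?d = "ultra_dist \<omega> x' (\<lambda>_. a')"
    have d: "((\<lambda>n. dist (x' n) a') \<longlongrightarrow> ?d) \<omega>" "?d \<in> {0..pi}"
      using tendsto_ultra_dist[of x' "\<lambda>_. a'"] x' a' by auto
    have "cos ?d = 1"
      using tendsto_unique[OF nontrivial tendsto_cos[OF d(1)] tendsto_ucos[of x' a']] a' by simp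
    then have "?d = 0" using d(2) cos_inj_pi[of ?d 0] by simp
    then show "((\<lambda>n. cos (dist (y' n) a') + dist (x' n) a') \<longlongrightarrow> ucos y' a') \<omega>"
      using tendsto_add[OF tendsto_ucos[of y' a'] d(1)] by simp
    have "cos (dist (x' n) (y' n)) \<le> cos (dist (y' n) a') + dist (x' n) a'" for n
      using abs_cos_diff_le[of "dist (x' n) (y' n)" "dist (y' n) a'"] abs_dist_diff_le[of "x' n" "y' n" a']
      by (simp add: dist_commute)
    then show "\<forall>\<^sub>F n in \<omega>. cos (dist (x' n) (y' n)) \<le> cos (dist (y' n) a') + dist (x' n) a'" by simp
  qed
  have "?L \<le> cos (dist a b)"
  proof -
    consider "cos (dist p a) = 0" | "cos (dist p b) = 0" | "0 < cos (dist p a)" "0 < cos (dist p b)"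
      using cos_center_nonneg ab by force
    then show ?thesis
    proof cases
      case 1
      then have "?L \<le> ucos y a" using in_U[of x a y, OF x ab(1) _ lim] a by simp
      also have "\<dots> \<le> cos (dist a b)" using bu[OF ab(1)] 1 by (simp add: dist_commute)
      finally show ?thesis .
    next
      case 2
      then have "?L \<le> ucos x b" using in_U[of y b x, OF y ab(2)] lim b by (simp add: dist_commute)
      also have "\<dots> \<le> cos (dist a b)" using au[OF ab(2)] 2 by simp
      finally show ?thesis .
    next
      case 3
      define A B where "A = cos (dist p a)" and "B = cos (dist p b)"
      have AB: "0 < A" "0 < B" using 3 by (simp_all add: A_def B_def)
      \<comment> \<open>A point closer to \<open>p\<close> than pi/2 has no point of
        \<open>U\<close> at distance pi, which \<open>cone_quadrilateral\<close> requires of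
        \<open>a\<close> and \<open>y n\<close>.\<close>
      have "dist p a \<noteq> pi / 2" using 3 by (metis cos_pi_half less_irrefl)
      then have "dist a (y n) < pi" for n
        using ball[OF ab(1)] ball[OF y[of n]] dist_triangle3[of a "y n" p] by simp
      \<comment> \<open>With these weights all terms containing \<open>c\<close> and \<open>c'\<close> cancel.\<close>
      then have quad: "B\<^sup>2 * cos (dist (x n) a) + A\<^sup>2 * cos (dist (y n) b) + B * A * (cos (dist a b) + cos (dist (x n) (y n)))
          \<le> B\<^sup>2 + A\<^sup>2 + B * A * (cos (dist (x n) b) + cos (dist (y n) a))" for n
        using cone_quadrilateral[OF x[of n] y[of n] ab] AB by blast
      have "B\<^sup>2 * ucos x a + A\<^sup>2 * ucos y b + B * A * (cos (dist a b) + ?L)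
          \<le> B\<^sup>2 + A\<^sup>2 + B * A * (ucos x b + ucos y a)"
      proof (rule tendsto_le[OF nontrivial])
        show "((\<lambda>n. B\<^sup>2 + A\<^sup>2 + B * A * (cos (dist (x n) b) + cos (dist (y n) a)))
            \<longlongrightarrow> B\<^sup>2 + A\<^sup>2 + B * A * (ucos x b + ucos y a)) \<omega>"
          by (intro tendsto_add tendsto_mult tendsto_const tendsto_ucos)
        show "((\<lambda>n. B\<^sup>2 * cos (dist (x n) a) + A\<^sup>2 * cos (dist (y n) b)
              + B * A * (cos (dist a b) + cos (dist (x n) (y n))))
            \<longlongrightarrow> B\<^sup>2 * ucos x a + A\<^sup>2 * ucos y b + B * A * (cos (dist a b) + ?L)) \<omega>"
          by (intro tendsto_add tendsto_mult tendsto_const tendsto_ucos lim)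
      qed (simp add: quad)
      moreover have "ucos x a = 1 - c * A" "ucos y b = 1 - c' * B"
        using a b by (simp_all add: A_def B_def algebra_simps)
      moreover have "B * A * (ucos x b + ucos y a) \<le> B * A * ((cos (dist a b) - c * B) + (cos (dist a b) - c' * A))"
        using au[OF ab(2)] bu[OF ab(1)] AB
        by (intro mult_left_mono add_mono) (auto simp: A_def B_def dist_commute)
      ultimately have "B * A * ?L \<le> B * A * cos (dist a b)"
        by (simp add: power2_eq_square algebra_simps)
      then show ?thesis using AB by simp
    qed
  qed
  then show ?thesis
    using tendsto_ultra_dist(2)[of x y, OF x y] dist_le_pi[OF ab] cos_monotone_0_pi[of "ultra_dist \<omega> x y" "dist a b"]
    by force
qed

lemma short_retraction_exists: "\<exists>R. short_retraction \<omega> U R"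
proof -
  define is_support where "is_support x a \<longleftrightarrow> a \<in> U \<and> (\<exists>c\<ge>0. ucos x a + c * cos (dist p a) = 1 \<and>
    (\<forall>u\<in>U. ucos x u + c * cos (dist p u) \<le> cos (dist a u)))" for x a
  define R where "R x = (SOME a. is_support x a)" for x
  have R: "is_support x (R x)" if "\<forall>n. x n \<in> U" for x
    unfolding R_def using support_point_exists[of x] that
    by (intro someI_ex[of "is_support x"]) (auto simp: is_support_def)
  have short: "dist (R x) (R y) \<le> ultra_dist \<omega> x y" if "\<forall>n. x n \<in> U" "\<forall>n. y n \<in> U" for x y
    using R[OF that(1)] R[OF that(2)] that unfolding is_support_def
    by (auto intro: support_points_short)
  \<comment> \<open>The support inequality tested at \<open>u\<close> itself gives
    \<open>1 \<le> cos (dist (R (\<lambda>_. u)) u)\<close>.\<close>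
  have "R (\<lambda>_. u) = u" if u: "u \<in> U" for u
  proof -
    have sup: "is_support (\<lambda>_. u) (R (\<lambda>_. u))" using R u by simp
    then obtain c where c: "0 \<le> c" "ucos (\<lambda>_. u) u + c * cos (dist p u) \<le> cos (dist (R (\<lambda>_. u)) u)"
      and RU: "R (\<lambda>_. u) \<in> U" using u unfolding is_support_def by blast
    have "ucos (\<lambda>_. u) u = 1" unfolding ucos_def by (simp add: tendsto_Lim[OF nontrivial])
    moreover have "0 \<le> c * cos (dist p u)"
      using cos_center_nonneg[OF u] c by simp
    ultimately have "cos (dist (R (\<lambda>_. u)) u) = cos 0"
      using c(2) cos_le_one[of "dist (R (\<lambda>_. u)) u"] unfolding cos_zero by linarith
    then show ?thesis using cos_inj_pi[of "dist (R (\<lambda>_. u)) u" 0] dist_le_pi[OF RU u] by simp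
  qed
  then show ?thesis using R short unfolding short_retraction_def is_support_def by blast
qed

end

theorem theorem1p3:
  fixes U :: "'a::metric_space set" and p :: 'a
  assumes "complete U" and "length_space U" and "CAT1 U"
    and "p \<in> U" and "\<forall>x\<in>U. dist p x \<le> pi / 2"
  shows "one_complemented U"
proof -
  obtain \<omega> where \<omega>: "nonprincipal_ultrafilter \<omega>" using nonprincipal_ultrafilter_exists ..
  interpret cat1_ball_ultrafilter U p \<omega>
    using assms \<omega> by unfold_locales (auto simp: nonprincipal_ultrafilter_def)
  show ?thesis using \<omega> short_retraction_exists unfolding one_complemented_def by blast
qed

end
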